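(* Let $H_{112,121}(x;k)=\sum_{n\ge0}f_{112,121}(n,k)x^n$. Then $H_{112,121}(x;0)=1$ and for every $k\ge1$, \[ H_{112,121}(x;k)=\frac{1}{1-x}H_{112,121}(x;k-1)+x^2\frac{d}{dx}H_{112,121}(x;k-1). \]
   Context: For integers $k,n\ge 0$, a word is an element of $[k]^n$, where $[k]=\{1,\dots,k\}$ is totally ordered. A pattern is a word $\tau\in[\ell]^m$ containing every letter $1,\dots,\ell$. A word $\sigma\in[k]^n$ contains $\tau$ if there are indices $1\le i_1<\dots<i_m\le n$ such that for all $1\le a,b\le m$ and each relation $\phi\in\{<,=,>\}$, $\sigma(i_a)\,\phi\,\sigma(i_b)$ holds iff $\tau(a)\,\phi\,\tau(b)$ holds; otherwise $\sigma$ avoids $\tau$. $f_{112,121}(n,k)$ is the number of words in $[k]^n$ that avoid both $112$ and $121$. Generating functions are formal power series in $x$. *)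

theory Defs
  imports "HOL-Computational_Algebra.Formal_Power_Series"
begin

definition words :: "nat \<Rightarrow> nat \<Rightarrow> nat list set" where
  "words k n = {w. length w = n \<and> set w \<subseteq> {1..k}}"

definition pattern :: "nat list \<Rightarrow> bool" where
  "pattern \<tau> \<longleftrightarrow> (\<exists>l. set \<tau> = {1..l})"

(* Lists are indexed from 0, so positions range over {..<n} instead of {1..n};
   the function i lists the chosen positions in increasing order. *)
definition contains_pattern :: "nat list \<Rightarrow> nat list \<Rightarrow> bool" where
  "contains_pattern \<sigma> \<tau> \<longleftrightarrow>
     (\<exists>i :: nat \<Rightarrow> nat.
        strict_mono_on {..<length \<tau>} i \<and>
        i ` {..<length \<tau>} \<subseteq> {..<length \<sigma>} \<and>
        (\<forall>a<length \<tau>. \<forall>b<length \<tau>.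
           (\<sigma> ! i a < \<sigma> ! i b \<longleftrightarrow> \<tau> ! a < \<tau> ! b) \<and>
           (\<sigma> ! i a = \<sigma> ! i b \<longleftrightarrow> \<tau> ! a = \<tau> ! b) \<and>
           (\<sigma> ! i a > \<sigma> ! i b \<longleftrightarrow> \<tau> ! a > \<tau> ! b)))"

definition avoids_pattern :: "nat list \<Rightarrow> nat list \<Rightarrow> bool" where
  "avoids_pattern \<sigma> \<tau> \<longleftrightarrow> \<not> contains_pattern \<sigma> \<tau>"

definition num_avoiding :: "nat list set \<Rightarrow> nat \<Rightarrow> nat \<Rightarrow> nat" where
  "num_avoiding T n k = card {\<sigma> \<in> words k n. \<forall>\<tau>\<in>T. avoids_pattern \<sigma> \<tau>}"

(* Rational coefficients, so that 1 - x is invertible via the library's division. *)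
definition avoid_gf :: "nat list set \<Rightarrow> nat \<Rightarrow> rat fps" where
  "avoid_gf T k = Abs_fps (\<lambda>n. of_nat (num_avoiding T n k))"

lemma pattern_112: "pattern [1, 1, 2]" and pattern_121: "pattern [1, 2, 1]"
  unfolding pattern_def by (rule exI[of _ 2], force)+

end

theory Submission
  imports Defs
begin

text \<open>Consider the copies of the smallest letter \<open>m\<close> in a word avoiding \<open>112\<close> and \<open>121\<close>. If there are at
  least two of them, then no larger letter follows the first one, so they form the end of the word.
  A single copy of \<open>m\<close> takes part in no occurrence of either pattern, so it may be inserted anywhere.
  Hence \<open>f (n, k) = (\<Sum>j \<noteq> 1. f (n - j, k - 1)) + n f (n - 1, k - 1)\<close>.\<close>

section \<open>A recursive criterion for avoiding both patterns\<close>

text \<open>If \<open>x\<close> occurs again in \<open>w\<close> and some larger \<open>y\<close>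
  occurs in \<open>w\<close>, then \<open>y\<close> lies before or after that second copy, which
  gives 121 or 112. One test per head letter therefore covers both patterns.\<close>

primrec avoider :: "'a::linorder list \<Rightarrow> bool" where
  "avoider [] \<longleftrightarrow> True"
| "avoider (x # w) \<longleftrightarrow> avoider w \<and> (x \<in> set w \<longrightarrow> (\<forall>y\<in>set w. y \<le> x))"

lemma all_nat_iff_0_Suc: "(\<forall>n. P n) \<longleftrightarrow> P 0 \<and> (\<forall>n. P (Suc n))"
  by (metis not0_implies_Suc)

lemma count_list_replicate [simp]: "count_list (replicate n x) y = (if x = y then n else 0)"
  by (induction n) auto

lemma all_less_3: "(\<forall>t<3. P t) \<longleftrightarrow> P 0 \<and> P (Suc 0) \<and> P (Suc (Suc 0))"
  by (auto simp: numeral_3_eq_3 All_less_Suc)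

lemma contains_pattern_length_3:
  "contains_pattern w [a, b, c] \<longleftrightarrow>
    (\<exists>p q r. p < q \<and> q < r \<and> r < length w \<and>
      (w ! p < w ! q \<longleftrightarrow> a < b) \<and> (w ! p = w ! q \<longleftrightarrow> a = b) \<and>
      (w ! p < w ! r \<longleftrightarrow> a < c) \<and> (w ! p = w ! r \<longleftrightarrow> a = c) \<and>
      (w ! q < w ! r \<longleftrightarrow> b < c) \<and> (w ! q = w ! r \<longleftrightarrow> b = c))" (is "?L \<longleftrightarrow> ?R")
proof
  assume ?L
  then obtain i where mono: "strict_mono_on {..<3} i" and im: "i ` {..<3} \<subseteq> {..<length w}"
    and eq: "\<And>s t. s < 3 \<Longrightarrow> t < 3 \<Longrightarrow>
           (w ! i s < w ! i t \<longleftrightarrow> [a, b, c] ! s < [a, b, c] ! t) \<and>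
           (w ! i s = w ! i t \<longleftrightarrow> [a, b, c] ! s = [a, b, c] ! t)"
    unfolding contains_pattern_def by (auto simp: numeral_3_eq_3)
  have "i 0 < i 1" "i 1 < i 2"
    by (auto intro!: strict_mono_onD[OF mono])
  moreover have "i 2 < length w"
    using im by (auto simp: image_subset_iff)
  ultimately show ?R
    using eq[of 0 1] eq[of 0 2] eq[of 1 2]
    by (intro exI[of _ "i 0"] exI[of _ "i 1"] exI[of _ "i 2"]) simp
next
  assume ?R
  then obtain p q r where pqr: "p < q" "q < r" "r < length w"
    and less: "w ! p < w ! q \<longleftrightarrow> a < b" "w ! p < w ! r \<longleftrightarrow> a < c" "w ! q < w ! r \<longleftrightarrow> b < c"
    and eq: "w ! p = w ! q \<longleftrightarrow> a = b" "w ! p = w ! r \<longleftrightarrow> a = c" "w ! q = w ! r \<longleftrightarrow> b = c"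
    by blast
  have greater: "w ! q < w ! p \<longleftrightarrow> b < a" "w ! r < w ! p \<longleftrightarrow> c < a" "w ! r < w ! q \<longleftrightarrow> c < b"
    using less eq by (metis not_less_iff_gr_or_eq)+
  \<comment> \<open>Only the values at 0, 1 and 2 matter; beyond them \<open>i\<close> is
    unspecified.\<close>
  define i where "i = (\<lambda>t. [p, q, r] ! t)"
  have i: "i 0 = p" "i (Suc 0) = q" "i (Suc (Suc 0)) = r"
    by (simp_all add: i_def)
  have "strict_mono_on {..<length [a, b, c]} i"
    unfolding strict_mono_on_def using pqr i
    by (auto simp: less_Suc_eq)
  moreover have "i ` {..<length [a, b, c]} \<subseteq> {..<length w}"
    using pqr i by (auto simp: less_Suc_eq)
  moreover have "\<forall>s<3. \<forall>t<3.
      (w ! i s < w ! i t \<longleftrightarrow> [a, b, c] ! s < [a, b, c] ! t) \<and>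
      (w ! i s = w ! i t \<longleftrightarrow> [a, b, c] ! s = [a, b, c] ! t) \<and>
      (w ! i s > w ! i t \<longleftrightarrow> [a, b, c] ! s > [a, b, c] ! t)"
    unfolding all_less_3 i using less eq greater by (simp add: eq_commute)
  ultimately show ?L
    unfolding contains_pattern_def by (intro exI[of _ i]) (simp add: numeral_3_eq_3)
qed

text \<open>Bridge from the recursion to positions. The order of \<open>q\<close> and
  \<open>r\<close> is deliberately left open, so that 112 and 121 are handled by one
  formula.\<close>

lemma avoider_iff_nth:
  "avoider w \<longleftrightarrow>
    (\<forall>p q r. p < q \<longrightarrow> p < r \<longrightarrow> q < length w \<longrightarrow> r < length w \<longrightarrow> w ! p = w ! q \<longrightarrow> w ! r \<le> w ! p)"
proof (induction w)
  case (Cons x w)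
  let ?P = "\<lambda>w p q r. p < q \<longrightarrow> p < r \<longrightarrow> q < length w \<longrightarrow> r < length w \<longrightarrow> w ! p = w ! q \<longrightarrow> w ! r \<le> w ! p"
  \<comment> \<open>With \<open>p\<close> in the tail, the cases \<open>q = 0\<close> and
    \<open>r = 0\<close> are vacuous and all three positions shift down by one.\<close>
  have Suc: "(\<forall>q r. ?P (x # w) (Suc p) q r) \<longleftrightarrow> (\<forall>q r. ?P w p q r)" for p
    by (subst (1 2) all_nat_iff_0_Suc) simp
  have "(\<forall>q r. ?P (x # w) 0 q r) \<longleftrightarrow> (x \<in> set w \<longrightarrow> (\<forall>y\<in>set w. y \<le> x))"
    by (subst (1 2) all_nat_iff_0_Suc) (simp add: in_set_conv_nth, metis in_set_conv_nth nth_mem)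
  then show ?case
    by (subst all_nat_iff_0_Suc) (simp only: Suc avoider.simps Cons, blast)
qed simp

lemma avoider_iff_avoids:
  "avoider w \<longleftrightarrow> (\<forall>\<tau>\<in>{[1, 1, 2], [1, 2, 1]}. avoids_pattern w \<tau>)"
proof
  assume "avoider w"
  then have *: "w ! r \<le> w ! p"
    if "p < q" "p < r" "q < length w" "r < length w" "w ! p = w ! q" for p q r
    using that unfolding avoider_iff_nth by blast
  have "\<not> contains_pattern w [1, 1, 2]"
  proof
    assume "contains_pattern w [1, 1, 2]"
    then obtain p q r where "p < q" "q < r" "r < length w" "w ! p = w ! q" "w ! p < w ! r"
      unfolding contains_pattern_length_3 by auto
    with *[of p q r] show False by simp
  qed
  moreover have "\<not> contains_pattern w [1, 2, 1]"
  proof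
    assume "contains_pattern w [1, 2, 1]"
    then obtain p q r where "p < q" "q < r" "r < length w" "w ! p = w ! r" "w ! p < w ! q"
      unfolding contains_pattern_length_3 by auto
    with *[of p r q] show False by simp
  qed
  ultimately show "\<forall>\<tau>\<in>{[1, 1, 2], [1, 2, 1]}. avoids_pattern w \<tau>"
    by (simp add: avoids_pattern_def)
next
  assume *: "\<forall>\<tau>\<in>{[1, 1, 2], [1, 2, 1]}. avoids_pattern w \<tau>"
  show "avoider w"
    unfolding avoider_iff_nth
  proof (intro allI impI, rule ccontr)
    fix p q r
    assume pqr: "p < q" "p < r" "q < length w" "r < length w" "w ! p = w ! q" "\<not> w ! r \<le> w ! p"
    \<comment> \<open>\<open>q = r\<close> is impossible, since \<open>w ! q\<close> equals
      \<open>w ! p\<close> while \<open>w ! r\<close> exceeds it.\<close>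
    then consider "q < r" | "r < q"
      by (metis linorder_neqE_nat order_refl)
    then show False
    proof cases
      case 1
      then have "contains_pattern w [1, 1, 2]"
        unfolding contains_pattern_length_3 using pqr
        by (intro exI[of _ p] exI[of _ q] exI[of _ r]) auto
      with * show ?thesis by (simp add: avoids_pattern_def)
    next
      case 2
      then have "contains_pattern w [1, 2, 1]"
        unfolding contains_pattern_length_3 using pqr
        by (intro exI[of _ p] exI[of _ r] exI[of _ q]) auto
      with * show ?thesis by (simp add: avoids_pattern_def)
    qed
  qed
qed

section \<open>Copies of the smallest letter\<close>

lemma avoider_map_Suc [simp]: "avoider (map Suc w) \<longleftrightarrow> avoider w"
  by (induction w) auto

text \<open>The inserted \<open>m\<close> has no second copy, so its own condition is vacuous, and
  being smaller than every other letter it violates no condition of a letter before it.\<close>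

lemma avoider_insert_least:
  assumes "\<forall>x\<in>set (xs @ ys). m < x"
  shows "avoider (xs @ m # ys) \<longleftrightarrow> avoider (xs @ ys)"
  using assms by (induction xs) (auto simp: less_imp_le)

lemma avoider_append_replicate_least:
  assumes "\<forall>x\<in>set xs. m < x"
  shows "avoider (xs @ replicate j m) \<longleftrightarrow> avoider xs"
proof -
  have "avoider (replicate j m)"
    by (induction j) auto
  then show ?thesis
    using assms by (induction xs) (auto simp: less_imp_le)
qed

text \<open>At the first \<open>m\<close> a further copy must follow, so \<open>avoider\<close>
  bounds the rest by \<open>m\<close> from above and minimality bounds it from below. A count of 0
  is allowed and gives an empty block.\<close>

lemma avoider_repeated_least:
  assumes "avoider w" "\<forall>x\<in>set w. m \<le> x" "count_list w m \<noteq> 1"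
  obtains xs where "w = xs @ replicate (count_list w m) m" "m \<notin> set xs"
  using assms
proof (induction w arbitrary: thesis)
  case (Cons x w)
  show ?case
  proof (cases "x = m")
    case True
    with Cons.prems have "m \<in> set w"
      by (auto simp: count_list_0_iff)
    with Cons.prems True have "\<forall>y\<in>set w. y = m"
      by (auto intro: antisym)
    with True have "x # w = replicate (length (x # w)) m"
      by (intro replicate_eqI) auto
    then have "x # w = [] @ replicate (count_list (x # w) m) m"
      by (metis append_Nil count_list_replicate)
    then show ?thesis
      using Cons.prems(1) by force
  next
    case False
    with Cons.IH Cons.prems obtain xs
      where "w = xs @ replicate (count_list w m) m" "m \<notin> set xs"
      by auto
    with False show ?thesis
      by (intro Cons.prems(1)[of "x # xs"]) auto
  qed
qed simp

section \<open>Counting by the number of copies of 1\<close>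

definition avoiders :: "nat \<Rightarrow> nat \<Rightarrow> nat list set" where
  "avoiders n k = {w \<in> words k n. avoider w}"

lemma num_avoiding_eq: "num_avoiding {[1, 1, 2], [1, 2, 1]} n k = card (avoiders n k)"
  by (simp only: num_avoiding_def avoiders_def avoider_iff_avoids)

lemma finite_avoiders [simp]: "finite (avoiders n k)"
proof -
  have "finite {w :: nat list. set w \<subseteq> {1..k} \<and> length w = n}"
    by (rule finite_lists_length_eq) simp
  then show ?thesis
    by (rule finite_subset[rotated]) (auto simp: avoiders_def words_def)
qed

lemma one_less_if_mem_words:
  assumes "w \<in> words k n" "1 \<notin> set w" "x \<in> set w"
  shows "1 < x"
proof -
  have "1 \<le> x" "x \<noteq> 1"
    using assms by (auto simp: words_def)
  then show ?thesis by simp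
qed

text \<open>Avoidance depends only on relative order, so words without the letter 1 correspond to
  words over an alphabet with one letter fewer.\<close>

lemma map_Suc_avoiders:
  "map Suc ` avoiders n k = {w \<in> avoiders n (Suc k). 1 \<notin> set w}"
proof (intro equalityI subsetI)
  fix w assume "w \<in> {w \<in> avoiders n (Suc k). 1 \<notin> set w}"
  then have w: "length w = n" "avoider w" "\<And>x. x \<in> set w \<Longrightarrow> 1 < x \<and> x \<le> Suc k"
    using one_less_if_mem_words[of w "Suc k" n] by (auto simp: avoiders_def words_def)
  define u where "u = map (\<lambda>x. x - 1) w"
  have wu: "w = map Suc u"
    unfolding u_def map_map by (rule map_idI[symmetric]) (auto dest: w(3))
  with w have "u \<in> avoiders n k"
    by (fastforce simp: avoiders_def words_def)
  with wu show "w \<in> map Suc ` avoiders n k" by blast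
qed (auto simp: avoiders_def words_def subset_iff)

text \<open>The index \<open>i\<close> is the position of the single 1, which may go into any of the
  \<open>n\<close> gaps of a word of length \<open>n - 1\<close>. For \<open>n = 0\<close> both
  sides are empty, so the truncated \<open>n - 1\<close> is harmless.\<close>

lemma avoiders_single_1:
  "{w \<in> avoiders n (Suc k). count_list w 1 = 1} =
    (\<lambda>(i, u). take i (map Suc u) @ 1 # drop i (map Suc u)) ` ({..<n} \<times> avoiders (n - 1) k)"
    (is "?A = ?f ` ?B")
proof (intro equalityI subsetI)
  fix w assume w: "w \<in> ?A"
  then obtain xs ys where xy: "w = xs @ 1 # ys"
    by (metis (mono_tags, lifting) count_list_0_iff mem_Collect_eq split_list zero_neq_one)
  with w have no1: "1 \<notin> set (xs @ ys)"
    by (auto simp: count_list_0_iff)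
  have "xs @ ys \<in> avoiders (n - 1) (Suc k)"
  proof -
    have "xs @ ys \<in> words (Suc k) (n - 1)"
      using w by (auto simp: xy avoiders_def words_def)
    from one_less_if_mem_words[OF this no1] have "\<forall>x\<in>set (xs @ ys). 1 < x"
      by blast
    then show ?thesis
      using w avoider_insert_least[of xs ys 1] by (auto simp: xy avoiders_def words_def)
  qed
  with no1 have "xs @ ys \<in> map Suc ` avoiders (n - 1) k"
    by (simp add: map_Suc_avoiders)
  then obtain u where u: "u \<in> avoiders (n - 1) k" "map Suc u = xs @ ys"
    by auto
  have "length xs < n"
    using w xy by (auto simp: avoiders_def words_def)
  then show "w \<in> ?f ` ?B"
    using u xy by (intro image_eqI[of _ _ "(length xs, u)"]) auto
next
  fix w assume "w \<in> ?f ` ?B"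
  then obtain i u where i: "i < n" and u: "u \<in> avoiders (n - 1) k"
    and w: "w = take i (map Suc u) @ 1 # drop i (map Suc u)"
    by auto
  define v where "v = map Suc u"
  have "v \<in> map Suc ` avoiders (n - 1) k"
    using u by (simp add: v_def)
  then have v: "v \<in> avoiders (n - 1) (Suc k)" "1 \<notin> set v"
    unfolding map_Suc_avoiders by simp_all
  have "\<forall>x\<in>set (take i v @ drop i v). 1 < x"
    using u unfolding append_take_drop_id by (auto simp: v_def avoiders_def words_def)
  from avoider_insert_least[OF this] have "avoider w"
    using v by (simp add: w v_def[symmetric] avoiders_def)
  moreover have "count_list w 1 = 1"
    using v set_take_subset[of i v] set_drop_subset[of i v]
    by (auto simp: w v_def[symmetric] count_list_0_iff)
  moreover have "w \<in> words (Suc k) n"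
    using v i set_take_subset[of i v] set_drop_subset[of i v]
    by (auto simp: w v_def[symmetric] avoiders_def words_def)
  ultimately show "w \<in> ?A"
    by (simp add: avoiders_def)
qed

lemma card_avoiders_single_1:
  "card {w \<in> avoiders n (Suc k). count_list w 1 = 1} = n * card (avoiders (n - 1) k)"
proof -
  let ?f = "\<lambda>(i, u). take i (map Suc u) @ 1 # drop i (map Suc u)"
  have "inj_on ?f ({..<n} \<times> avoiders (n - 1) k)"
  proof (rule inj_onI, clarify)
    fix i u j v
    assume u: "i < n" "u \<in> avoiders (n - 1) k" "j < n" "v \<in> avoiders (n - 1) k"
      and eq: "take i (map Suc u) @ 1 # drop i (map Suc u) = take j (map Suc v) @ 1 # drop j (map Suc v)"
    have "1 \<notin> set (map Suc u)" "1 \<notin> set (map Suc v)"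
      using u by (auto simp: avoiders_def words_def)
    then have "1 \<notin> set (take i (map Suc u))" "1 \<notin> set (drop i (map Suc u))"
      using set_take_subset set_drop_subset by fast+
    \<comment> \<open>There is no other 1 on either side of the inserted one, so equal words split
      at the same place.\<close>
    then have 1: "take i (map Suc u) = take j (map Suc v)" "drop i (map Suc u) = drop j (map Suc v)"
      using eq by (simp_all add: append_Cons_eq_iff)
    then have "map Suc u = map Suc v"
      by (metis append_take_drop_id)
    \<comment> \<open>Both words have length \<open>n - 1\<close> and \<open>i\<close>,
      \<open>j\<close> are below \<open>n\<close>, so the prefixes have lengths exactly
      \<open>i\<close> and \<open>j\<close>.\<close>
    moreover have "i = j"
      using arg_cong[OF 1(1), of length] u by (auto simp: avoiders_def words_def)
    ultimately show "i = j \<and> u = v"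
      by (simp add: inj_map_eq_map)
  qed
  then show ?thesis
    unfolding avoiders_single_1 by (simp add: card_image card_cartesian_product)
qed

text \<open>Here \<open>j\<close> is the number of ones. The case \<open>j = 0\<close> has the same
  shape as \<open>j\<close> at least 2: the ones form a final block, possibly empty.\<close>

lemma avoiders_not_single_1:
  "{w \<in> avoiders n (Suc k). count_list w 1 \<noteq> 1} =
    (\<lambda>(j, u). map Suc u @ replicate j 1) ` (SIGMA j:{..n} - {1}. avoiders (n - j) k)"
    (is "?A = ?f ` ?B")
proof (intro equalityI subsetI)
  fix w assume w: "w \<in> ?A"
  define j where "j = count_list w 1"
  have ge1: "\<forall>x\<in>set w. 1 \<le> x"
    using w by (auto simp: avoiders_def words_def)
  with w obtain xs where xs: "w = xs @ replicate j 1" "1 \<notin> set xs"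
    using avoider_repeated_least[of w 1] by (auto simp: j_def avoiders_def)
  have j: "j \<in> {..n} - {1}"
    using w count_le_length[of w 1] by (auto simp: j_def avoiders_def words_def)
  have "xs \<in> words (Suc k) (n - j)"
    using w by (auto simp: xs(1) avoiders_def words_def)
  then have "\<forall>x\<in>set xs. 1 < x"
    using one_less_if_mem_words xs(2) by blast
  then have "avoider xs"
    using w avoider_append_replicate_least[of xs 1 j] xs(1) by (simp add: avoiders_def)
  then have "xs \<in> map Suc ` avoiders (n - j) k"
    using w xs(2) unfolding map_Suc_avoiders by (auto simp: xs(1) avoiders_def words_def)
  with j xs(1) show "w \<in> ?f ` ?B"
    by force
next
  fix w assume "w \<in> ?f ` ?B"
  then obtain j u where j: "j \<le> n" "j \<noteq> 1" and u: "u \<in> avoiders (n - j) k"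
    and w: "w = map Suc u @ replicate j 1"
    by auto
  have gt: "\<forall>x\<in>set (map Suc u). 1 < x"
    using u by (auto simp: avoiders_def words_def)
  then have "avoider w"
    using u unfolding w avoider_append_replicate_least[OF gt] by (simp add: avoiders_def)
  moreover have "1 \<notin> set (map Suc u)"
    using gt by blast
  then have "count_list w 1 = j"
    by (simp add: w count_list_0_iff[THEN iffD2] del: set_map)
  ultimately show "w \<in> ?A"
    using u j by (auto simp: avoiders_def words_def w)
qed

lemma card_avoiders_not_single_1:
  "card {w \<in> avoiders n (Suc k). count_list w 1 \<noteq> 1} = (\<Sum>j\<in>{..n} - {1}. card (avoiders (n - j) k))"
proof -
  let ?f = "\<lambda>(j, u). map Suc u @ replicate j (1::nat)"
  have "inj_on ?f (SIGMA j:{..n} - {1}. avoiders (n - j) k)"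
  proof (rule inj_onI)
    fix x y
    assume x: "x \<in> (SIGMA j:{..n} - {1}. avoiders (n - j) k)"
      and y: "y \<in> (SIGMA j:{..n} - {1}. avoiders (n - j) k)" and f: "?f x = ?f y"
    obtain i u j v where xy: "x = (i, u)" "y = (j, v)"
      by (cases x, cases y)
    have u: "u \<in> avoiders (n - i) k" "v \<in> avoiders (n - j) k"
      and eq: "map Suc u @ replicate i 1 = map Suc v @ replicate j (1::nat)"
      using x y f by (auto simp: xy)
    have "1 \<notin> set (map Suc u)" "1 \<notin> set (map Suc v)"
      using u by (auto simp: avoiders_def words_def)
    \<comment> \<open>The shifted parts contain no 1, so counting ones recovers the length of the
      final block.\<close>
    then have "i = j"
      using arg_cong[OF eq, of "\<lambda>w. count_list w 1"]
      by (simp add: count_list_0_iff[THEN iffD2] del: set_map)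
    with eq show "x = y"
      by (simp add: xy inj_map_eq_map)
  qed
  then show ?thesis
    unfolding avoiders_not_single_1 by (simp add: card_image)
qed

text \<open>Of the \<open>n\<close> copies of the insertion term, one fills the gap at
  \<open>j = 1\<close> in the sum over final blocks, leaving a full sum and the factor
  \<open>n - 1\<close>.\<close>

lemma card_avoiders_Suc:
  "card (avoiders n (Suc k)) =
    (\<Sum>j\<le>n. card (avoiders j k)) + (n - 1) * card (avoiders (n - 1) k)"
proof -
  let ?c = "\<lambda>j. card (avoiders j k)"
  have "card (avoiders n (Suc k)) = card ({w \<in> avoiders n (Suc k). count_list w 1 \<noteq> 1} \<union>
      {w \<in> avoiders n (Suc k). count_list w 1 = 1})"
    by (rule arg_cong[of _ _ card]) blast
  also have "\<dots> = card {w \<in> avoiders n (Suc k). count_list w 1 \<noteq> 1} +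
      card {w \<in> avoiders n (Suc k). count_list w 1 = 1}"
    by (rule card_Un_disjoint) auto
  also have "\<dots> = (\<Sum>j\<in>{..n} - {1}. ?c (n - j)) + n * ?c (n - 1)"
    by (simp only: card_avoiders_not_single_1 card_avoiders_single_1)
  also have "\<dots> = (\<Sum>j\<le>n. ?c (n - j)) + (n - 1) * ?c (n - 1)"
  \<comment> \<open>For \<open>n = 0\<close> there is no term at \<open>j = 1\<close> to fill in,
    and both factors \<open>n\<close> and \<open>n - 1\<close> are 0.\<close>
  proof (cases n)
    case (Suc m)
    then have "(\<Sum>j\<le>n. ?c (n - j)) = ?c (n - 1) + (\<Sum>j\<in>{..n} - {1}. ?c (n - j))"
      by (intro sum.remove) auto
    with Suc show ?thesis by simp
  qed simp
  also have "(\<Sum>j\<le>n. ?c (n - j)) = (\<Sum>j\<le>n. ?c j)"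
    using sum.atLeastAtMost_rev[of ?c 0 n] by (simp add: atLeast0AtMost)
  finally show ?thesis .
qed

section \<open>From the recurrence to generating functions\<close>

lemma card_avoiders_0: "card (avoiders n 0) = (if n = 0 then 1 else 0)"
proof -
  have "avoiders n 0 = (if n = 0 then {[]} else {})"
    by (auto simp: avoiders_def words_def)
  then show ?thesis by simp
qed

theorem theorem6:
  shows "avoid_gf {[1, 1, 2], [1, 2, 1]} 0 = 1 \<and>
    (\<forall>k\<ge>1. avoid_gf {[1, 1, 2], [1, 2, 1]} k =
       1 / (1 - fps_X) * avoid_gf {[1, 1, 2], [1, 2, 1]} (k - 1)
       + fps_X ^ 2 * fps_deriv (avoid_gf {[1, 1, 2], [1, 2, 1]} (k - 1)))"
proof (intro conjI allI impI)
  have gf: "avoid_gf {[1, 1, 2], [1, 2, 1]} k = Abs_fps (\<lambda>n. of_nat (card (avoiders n k)))" for k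
    by (simp only: avoid_gf_def num_avoiding_eq)
  show "avoid_gf {[1, 1, 2], [1, 2, 1]} 0 = 1"
    unfolding gf by (rule fps_ext) (simp add: card_avoiders_0)
  fix k :: nat assume "1 \<le> k"
  then obtain l where k: "k = Suc l"
    by (cases k) auto
  let ?H = "avoid_gf {[1, 1, 2], [1, 2, 1]} l"
  \<comment> \<open>Written as a quotient, the product is a series divided by
    \<open>1 - fps_X\<close>, whose coefficients are partial sums.\<close>
  have "1 / (1 - fps_X) * ?H = ?H / (1 - fps_X)"
    by (simp add: fps_divide_unit)
  then have geom: "fps_nth (1 / (1 - fps_X) * ?H) n = (\<Sum>j\<le>n. of_nat (card (avoiders j l)))" for n
    unfolding gf by (simp add: fps_divide_fps_X_minus1_sum atLeast0AtMost)
  have deriv: "fps_nth (fps_X ^ 2 * fps_deriv ?H) n = of_nat ((n - 1) * card (avoiders (n - 1) l))" for n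
  \<comment> \<open>For \<open>n\<close> equal to 0 or 1 the factor \<open>fps_X ^ 2\<close> kills
    the left side, and \<open>n - 1\<close> is 0 by truncation or exactly. For
    \<open>n = m + 2\<close> the coefficient of the derivative at \<open>m\<close> carries the
    factor \<open>m + 1 = n - 1\<close>.\<close>
  proof (cases "n < 2")
    case True
    then show ?thesis by (auto simp: fps_X_power_mult_nth)
  next
    case False
    then obtain m where "n = Suc (Suc m)"
      by (metis less_2_cases_iff not0_implies_Suc One_nat_def)
    then show ?thesis
      unfolding gf by (simp add: fps_X_power_mult_nth algebra_simps)
  qed
  show "avoid_gf {[1, 1, 2], [1, 2, 1]} k =
      1 / (1 - fps_X) * avoid_gf {[1, 1, 2], [1, 2, 1]} (k - 1)
      + fps_X ^ 2 * fps_deriv (avoid_gf {[1, 1, 2], [1, 2, 1]} (k - 1))"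
    unfolding k diff_Suc_1
    by (rule fps_ext) (simp only: fps_add_nth geom deriv, simp only: gf fps_nth_Abs_fps card_avoiders_Suc of_nat_add of_nat_sum)
qed

end
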